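(* For all $a\in(1,2]$, with $A=1-\frac1a$, the fixed point $(A,A)$ of $F_a$ is locally asymptotically stable, and $\lim_{n\to\infty}F_a^n(x,y)=(A,A)$ for every $(x,y)\in S_a$.
   Context: For a real parameter $a$, $F_a:\mathbb{R}^2\to\mathbb{R}^2$ is the (delayed logistic) map $F_a(x,y)=(y,\;a y(1-x))$, and $F_a^n$ denotes its $n$-fold iterate. The set $S_a$ is $$S_a=\{(x,y)\in\mathbb{R}^2:\ 0\le x<1,\ 0<y<1,\ a y(1-x)<1\}.$$ *)

theory Defs
  imports "HOL-Analysis.Analysis"
begin

definition F :: "real \<Rightarrow> real \<times> real \<Rightarrow> real \<times> real" where
  "F a = (\<lambda>(x, y). (y, a * y * (1 - x)))"

definition S :: "real \<Rightarrow> (real \<times> real) set" where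
  "S a = {(x, y). 0 \<le> x \<and> x < 1 \<and> 0 < y \<and> y < 1 \<and> a * y * (1 - x) < 1}"

definition is_fixed_point :: "('a \<Rightarrow> 'a) \<Rightarrow> 'a \<Rightarrow> bool" where
  "is_fixed_point f p \<longleftrightarrow> f p = p"

definition lyapunov_stable :: "('a::metric_space \<Rightarrow> 'a) \<Rightarrow> 'a \<Rightarrow> bool" where
  "lyapunov_stable f p \<longleftrightarrow>
     (\<forall>\<epsilon>>0. \<exists>\<delta>>0. \<forall>z. dist z p < \<delta> \<longrightarrow> (\<forall>n. dist ((f ^^ n) z) p < \<epsilon>))"

definition locally_attracting :: "('a::metric_space \<Rightarrow> 'a) \<Rightarrow> 'a \<Rightarrow> bool" where
  "locally_attracting f p \<longleftrightarrow>
     (\<exists>\<eta>>0. \<forall>z. dist z p < \<eta> \<longrightarrow> (\<lambda>n. (f ^^ n) z) \<longlonglongrightarrow> p)"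

definition locally_asymptotically_stable :: "('a::metric_space \<Rightarrow> 'a) \<Rightarrow> 'a \<Rightarrow> bool" where
  "locally_asymptotically_stable f p \<longleftrightarrow> lyapunov_stable f p \<and> locally_attracting f p"

end

(*
Put c = a - 1 and p = a x - c. Along an orbit c + p'' = (c + p') (1 - p), and the claim is p --> 0.

A new maximum r of p is preceded by v, w with v <= 0 and c + r = (c + v)(1 - v)(1 - w), so p >= -B eventually
forces p <= c B eventually; dually, an eventual upper bound P forces an eventual lower bound.  For c <= 9/10 iterating
the two bounds contracts.  At c = 1 the linear part has order 6 and they do not; for c >= 9/10 they are only used to
trap the orbit in the box [-3/5, 19/40].  There the quartic polynomial V below strictly decreases: it is the
invariant quadratic form p^2 - p q + q^2 of the linear part at c = 1, corrected by cubic and quartic terms so that its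
increment there is -(p^2 - p q + q^2)^2 / 3 plus terms of order at least 5.  For c < 1 only the quadratic form is adapted.
*)

theory Submission
  imports Defs
begin

text \<open>Multiplied out by these rules, the polynomial inequalities below become linear in their
  monomials and fall to linear arithmetic.\<close>

lemmas expand = algebra_simps power2_eq_square power3_eq_cube times_divide_eq_left times_divide_eq_right
  add_divide_distrib diff_divide_distrib
  mult_minus_left mult_minus_right minus_add_distrib minus_diff_eq

section \<open>The Lyapunov function\<close>

text \<open>These are the terms of order at least 5 in the increment of the Lyapunov polynomial at
  \<open>c = 1\<close>, and \<open>s + m\<close> is the invariant form. Against the leading
  coefficient \<open>-1/3\<close>, the bound \<open>97/300\<close> leaves a net descent of
  \<open>1/100\<close>.\<close>

lemma quartic_part_le:
  fixes p q :: real
  assumes p: "- 3/5 \<le> p" "p \<le> 19/40" and q: "- 3/5 \<le> q" "q \<le> 19/40"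
  defines "s \<equiv> (p - q)^2" and "m \<equiv> p * q"
  shows "q * m * s / 2 + m^2 * (q * (3 * p - q) / 2 + 2/3 * (q * m)) \<le> 97/300 * (s + m)^2"
proof -
  have s: "s \<ge> 0" by (simp add: s_def)
  consider "p \<ge> 0" "q \<ge> 0" | "p \<ge> 0" "q \<le> 0" | "p \<le> 0" "q \<ge> 0" | "p \<le> 0" "q \<le> 0" by linarith
  then show ?thesis
  proof cases
    case 1
    have m: "m \<ge> 0" using 1 by (simp add: m_def)
    have "q * (3 * p - q) \<le> q * (3 * (19/40) - q)" using 1 p by (intro mult_left_mono) auto
    moreover have "(19/40 - q) * (2 * (19/40) - q) \<ge> 0" using q by (intro mult_nonneg_nonneg) auto
    ultimately have k: "q * (3 * p - q) / 2 \<le> (19/40)^2" by (simp add: algebra_simps power2_eq_square)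
    have "q * m \<le> 19/40 * (19/40 * (19/40))" unfolding m_def using 1 p q by (intro mult_mono) auto
    with k have "q * (3 * p - q) / 2 + 2/3 * (q * m) \<le> 3/10" by (simp add: power2_eq_square)
    then have "m^2 * (q * (3 * p - q) / 2 + 2/3 * (q * m)) \<le> m^2 * (3/10)" by (rule mult_left_mono) simp
    moreover have "q * (m * s) \<le> 19/40 * (m * s)" using q m s by (intro mult_right_mono) auto
    moreover have "m * s \<ge> 0" "m^2 \<ge> 0" "s^2 \<ge> 0" using m s by auto
    moreover have "(s + m)^2 = s^2 + 2 * (m * s) + m^2" "q * m * s = q * (m * s)" by (simp_all add: power2_sum)
    ultimately show ?thesis by linarith
  next
    case 2
    define n where "n = - m"
    have n: "n \<ge> 0" using 2 by (simp add: n_def m_def mult_nonneg_nonpos)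
    have sn: "s \<ge> 4 * n" using zero_le_power2[of "p + q"] by (simp add: n_def m_def s_def power2_eq_square algebra_simps)
    have n1: "n \<le> 19/40 * (3/5)" unfolding n_def m_def using 2 p q mult_mono[of p "19/40" "-q" "3/5"] by simp
    have k: "q * (3 * p - q) / 2 \<le> 0" using 2 by (simp add: mult_nonpos_nonneg)
    have "(- q) * n \<le> 3/5 * (19/40 * (3/5))" using 2 p q n n1 by (intro mult_mono) auto
    with k have "q * (3 * p - q) / 2 + 2/3 * (q * m) \<le> 3/25" by (simp add: n_def)
    then have "m^2 * (q * (3 * p - q) / 2 + 2/3 * (q * m)) \<le> m^2 * (3/25)" by (rule mult_left_mono) simp
    moreover have "(- q) * (n * s) \<le> 3/5 * (n * s)" using q n s by (intro mult_right_mono) auto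
    moreover have "n * s \<le> 1/4 * (s * s)" using mult_right_mono[OF sn s] by simp
    moreover have "(s + m)^2 = s^2 - 2 * (n * s) + n^2" "q * m * s = - q * (n * s)" "m^2 = n^2"
      "s^2 = s * s" "n^2 = n * n"
      by (simp_all add: n_def power2_eq_square algebra_simps)
    ultimately show ?thesis using zero_le_square[of s] zero_le_square[of n] by linarith
  next
    case 3
    have m: "m \<le> 0" using 3 by (simp add: m_def mult_nonpos_nonneg)
    have "q * m \<le> 0" using 3 m by (simp add: mult_nonneg_nonpos)
    moreover from this have "(q * m) * s \<le> 0" using s by (rule mult_nonpos_nonneg)
    moreover have "q * (3 * p - q) \<le> 0" using 3 by (simp add: mult_nonneg_nonpos)
    ultimately have "q * m * s / 2 \<le> 0" "m^2 * (q * (3 * p - q) / 2 + 2/3 * (q * m)) \<le> 0"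
      by (auto intro!: mult_nonneg_nonpos)
    then show ?thesis using zero_le_power2[of "s+m"] by linarith
  next
    case 4
    have m: "m \<ge> 0" using 4 by (simp add: m_def mult_nonpos_nonpos)
    have "q * (m * s) \<le> 0" using 4 m s by (intro mult_nonpos_nonneg) auto
    moreover have "q * (3 * p - q) / 2 + 2/3 * (q * m) \<le> 9/40"
    proof -
      \<comment> \<open>The expression is largest at \<open>p = - 3/5\<close>, where it becomes
        \<open>9/10 * v * (1 - v)\<close> with \<open>v = - q\<close>; this is at most
        \<open>9/40\<close>, attained at \<open>v = 1/2\<close>.\<close>
      have "(- q) * ((- p - 3/5) * (3/2 - 2/3 * (- q))) \<le> 0"
        using 4 p q by (intro mult_nonneg_nonpos mult_nonpos_nonneg) auto
      moreover have "(q + 1/2)^2 \<ge> 0" by simp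
      ultimately show ?thesis unfolding m_def by (simp (no_asm_use) only: expand)
    qed
    then have "m^2 * (q * (3 * p - q) / 2 + 2/3 * (q * m)) \<le> m^2 * (9/40)" by (rule mult_left_mono) simp
    moreover have "m * s \<ge> 0" "m^2 \<ge> 0" "s^2 \<ge> 0" using m s by auto
    moreover have "(s + m)^2 = s^2 + 2 * (m * s) + m^2" "q * m * s = q * (m * s)" by (simp_all add: power2_sum)
    ultimately show ?thesis by linarith
  qed
qed

text \<open>This is the part of the increment that is exactly linear in \<open>1 - c\<close>. The
  reserve \<open>43/200 * p^2\<close> pays for the higher powers of \<open>1 - c\<close>, bounded in
  \<open>correction_le\<close>.\<close>

lemma quadratic_part_le:
  fixes p q :: real
  assumes p: "- 3/5 \<le> p" "p \<le> 19/40" and q: "- 3/5 \<le> q" "q \<le> 19/40"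
  shows "- (p^2 - p * q + q^2) + p * (3 * p - q) * (p - q) / 2 + p * q * (p^2 + p * q - q^2 / 2)
        + p^2 * q^2 * (q - 5/2 * p) - 2 * p^3 * q^3 \<le> - (43/200 * p^2)"
proof -
  consider "p \<ge> 0" "q \<ge> 0" | "p \<ge> 0" "q \<le> 0" | "p \<le> 0" "q \<ge> 0" | "p \<le> 0" "q \<le> 0" by linarith
  then show ?thesis
  proof cases
    case 1
    have "p * (19/40 - p) \<ge> 0" using 1 p by (intro mult_nonneg_nonneg) auto
    then have pp: "p^2 \<le> 19/40 * p" by (simp add: algebra_simps power2_eq_square)
    \<comment> \<open>Half of \<open>q^2\<close> completes the square with the cross term
      \<open>p * (1 - p)^2 * q\<close>. What remains is
      \<open>(1 - p)^4 \<le> 2 * (157/200 - 3/2 * p)\<close>, where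
      \<open>157/200 = 1 - 43/200\<close>.\<close>
    then have "(1 - p)^2 \<le> 1 - 61/40 * p" by (simp add: algebra_simps power2_eq_square)
    then have "((1 - p)^2)^2 \<le> (1 - 61/40 * p)^2" by (intro power_mono) auto
    also have "\<dots> = 1 - 61/20 * p + 3721/1600 * p^2" by (simp add: algebra_simps power2_eq_square)
    also have "\<dots> \<le> 2 * (157/200 - 3/2 * p)" using pp p by simp
    finally have "p^2 * ((1 - p)^2)^2 \<le> p^2 * (2 * (157/200 - 3/2 * p))" by (rule mult_left_mono) simp
    moreover have "(p * (1 - p)^2 - q)^2 \<ge> 0" by simp
    moreover have "q^2 * (1/2 - p / 2 - p^2) \<ge> 0" using pp p by (intro mult_nonneg_nonneg) auto
    moreover have "p * q^3 * (1/2 - p) \<ge> 0" "p^3 * q^2 \<ge> 0" "p^3 * q^3 \<ge> 0" using 1 p by auto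
    ultimately show ?thesis by (simp (no_asm_use) only: expand)
  next
    case 2
    define v where "v = - q"
    have v: "0 \<le> v" "v \<le> 3/5" using 2 q by (auto simp: v_def)
    have pv: "p * v \<ge> 0" using 2 v by simp
    have pp: "p * p \<le> 19/40 * (19/40)" and vv: "p * v \<le> 19/40 * (3/5)"
      using 2 p v by (intro mult_mono; simp)+
    have "p^2 * p \<le> p^2 * (19/40)" "p * v * p \<le> p * v * (19/40)" "v^2 * p \<le> v^2 * (19/40)"
      using p pv by (intro mult_left_mono; simp)+
    moreover have "v^2 * (p * p) \<le> v^2 * (361/1600)" "v^2 * (p * v) \<le> v^2 * (57/200)"
      using pp vv by (intro mult_left_mono; simp)+
    moreover have "v^2 * ((p * p) * (p * v)) \<le> v^2 * (361/1600 * (57/200))"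
      using pp vv pv by (intro mult_left_mono mult_mono) auto
    moreover have "p^3 * v \<ge> 0" "p^2 * v^3 \<ge> 0" "p^3 * v^2 \<ge> 0" "p^2 \<ge> 0" "v^2 \<ge> 0" using 2 v by auto
    ultimately have "- (p^2 + p * v + v^2) + p * (3 * p + v) * (p + v) / 2 - p * v * (p^2 - p * v - v^2 / 2)
        + p^2 * v^2 * (- v - 5/2 * p) + 2 * p^3 * v^3 \<le> - (43/200 * p^2)"
      using pv by (simp (no_asm_use) only: expand)
    then show ?thesis by (simp add: v_def)
  next
    case 3
    define u where "u = - p"
    have u: "0 \<le> u" "u \<le> 3/5" using 3 p by (auto simp: u_def)
    have uq: "u * q \<ge> 0" using u 3 by simp
    have uq': "u * q \<le> 57/200" using mult_mono[of u "3/5" q "19/40"] u 3 q by simp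
    have qq: "q * q \<le> 361/1600" using mult_mono[of q "19/40" q "19/40"] 3 q by simp
    have "u * q * (u * q) \<le> u * q * (57/200)" "u * q * (q * q) \<le> u * q * (361/1600)"
      using uq uq' qq by (intro mult_left_mono; simp)+
    moreover have "u * q * (u * q * (q + 5/2 * u)) \<le> u * q * (57/200 * 2)"
      using uq uq' u 3 q by (intro mult_left_mono mult_mono) auto
    moreover have "u * q * (u * q * (u * q)) \<le> u * q * (57/200 * (57/200))"
      using uq uq' by (intro mult_left_mono mult_mono) auto
    moreover have "(u - q)^2 \<ge> 0" "u^2 \<ge> 0" "q^2 \<ge> 0" "u^3 \<ge> 0" "u^2 * q \<ge> 0" "u * q^2 \<ge> 0" "u^3 * q \<ge> 0" using u 3 by auto
    ultimately have "- (u^2 + u * q + q^2) - u * (3 * u + q) * (u + q) / 2 - u * q * (u^2 - u * q - q^2 / 2)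
        + u^2 * q^2 * (q + 5/2 * u) + 2 * u^3 * q^3 \<le> - (43/200 * u^2)"
      using uq by (simp (no_asm_use) only: expand)
    then show ?thesis by (simp add: u_def algebra_simps add_divide_distrib diff_divide_distrib)
  next
    case 4
    define u v where "u = - p" and "v = - q"
    have u: "0 \<le> u" "u \<le> 3/5" and v: "0 \<le> v" "v \<le> 3/5" using 4 p q by (auto simp: u_def v_def)
    \<comment> \<open>\<open>\<beta>\<close> lies just above the chord over \<open>[0, 3/5]\<close>
      of the convex function of \<open>u\<close> that multiplies \<open>u * v\<close> once
      \<open>v^3\<close> has been replaced by its quadratic minorant.\<close>
    define \<beta> where "\<beta> = 144/125 + 3266/1000 * u"
    have uu: "u * u \<le> 3/5 * u" using u by (intro mult_right_mono) auto
    \<comment> \<open>The discriminant condition that makes the quadratic form \<open>main\<close>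
      in \<open>u\<close> and \<open>v\<close> nonnegative.\<close>
    have "\<beta>^2 \<le> 4 * (157/200 + 3/2 * u) * (1 + u)"
      using uu u unfolding \<beta>_def by (simp (no_asm_use) only: expand)
    then have "u^2 * \<beta>^2 \<le> u^2 * (4 * (157/200 + 3/2 * u) * (1 + u))" by (rule mult_left_mono) simp
    moreover have "(2 * (1 + u) * v - \<beta> * u)^2 \<ge> 0" by simp
    ultimately have "4 * (1 + u) * ((157/200 + 3/2 * u) * u^2 - \<beta> * (u * v) + (1 + u) * v^2) \<ge> 0"
      by (simp (no_asm_use) only: expand)
    then have main: "(157/200 + 3/2 * u) * u^2 - \<beta> * (u * v) + (1 + u) * v^2 \<ge> 0"
      using u by (simp add: zero_le_mult_iff)
    \<comment> \<open>replaces the cubic \<open>v\<^sup>3\<close> by a quadratic touching it near the extremal point, leaving a quadratic form in \<open>(u, v)\<close>\<close>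
    have tangent: "(u / 2 + u^2 + 2 * u^3) * (v * (v - 11/20)^2) \<ge> 0" using u v by simp
    have "(1 + u)^2 + 121/400 * (1/2 + u + 2 * u^2) \<le> \<beta>"
      using uu u unfolding \<beta>_def by (simp (no_asm_use) only: expand)
    then have b: "(u * v) * ((1 + u)^2 + 121/400 * (1/2 + u + 2 * u^2)) \<le> (u * v) * \<beta>"
      using u v by (intro mult_left_mono) auto
    have "1 / 20 + u / 10 - 3/10 * u^2 \<ge> 0" using uu u by (simp add: power2_eq_square)
    then have "v^2 * (u * (1 / 20 + u / 10 - 3/10 * u^2)) \<ge> 0" using u by simp
    with main tangent b have "- (u^2 - u * v + v^2) - u * (3 * u - v) * (u - v) / 2 + u * v * (u^2 + u * v - v^2 / 2)
        + u^2 * v^2 * (5/2 * u - v) - 2 * u^3 * v^3 \<le> - (43/200 * u^2)"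
      by (simp (no_asm_use) only: expand)
    then show ?thesis by (simp add: u_def v_def algebra_simps add_divide_distrib diff_divide_distrib)
  qed
qed

text \<open>Here \<open>e\<close> stands for \<open>1 - c\<close>. The estimates add up because
  \<open>1/10 * 52/25 + 1/100 * 11/20\<close> is below \<open>43/200\<close>.\<close>

lemma correction_le:
  fixes p q e :: real
  assumes p: "- 3/5 \<le> p" "p \<le> 19/40" and q: "- 3/5 \<le> q" "q \<le> 19/40" and e: "0 \<le> e" "e \<le> 1/10"
  shows "e * p^2 * (1 - 3/2 * p + p * q / 2 - q^2 / 2 + 2 * p * q^2) + e^2 * p^3 * (1/2 - 2/3 * q)
    \<le> 43/200 * p^2"
proof -
  have q2: "q^2 \<le> (3/5)^2" using q by (simp add: abs_le_square_iff[symmetric])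
  have pq: "p * q \<le> \<bar>p\<bar> * (3/5)" 
  proof -
    have "p * q \<le> \<bar>p\<bar> * \<bar>q\<bar>" by (metis abs_ge_self abs_mult)
    also have "\<dots> \<le> \<bar>p\<bar> * (3/5)" using q by (intro mult_left_mono) auto
    finally show ?thesis .
  qed
  have "1 - 3/2 * p + p * q / 2 - q^2 / 2 + 2 * p * q^2 \<le> 52/25"
  proof (cases "p \<ge> 0")
    case True
    then have "p * q^2 \<le> 19/40 * (9/25)" using p q2 by (intro mult_mono) (auto simp: power2_eq_square)
    then show ?thesis using pq p True zero_le_power2[of q] by linarith
  next
    case False
    then have "p * q^2 \<le> 0" by (simp add: mult_nonpos_nonneg)
    then show ?thesis using pq p False zero_le_power2[of q] by linarith
  qed
  then have 1: "e * p^2 * (1 - 3/2 * p + p * q / 2 - q^2 / 2 + 2 * p * q^2) \<le> (1/10 * p^2) * (52/25)"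
    using e by (intro order.trans[OF mult_left_mono mult_right_mono] mult_right_mono) auto
  have "p * (1/2 - 2/3 * q) \<le> \<bar>p\<bar> * (1/2 - 2/3 * q)" using q by (intro mult_right_mono) auto
  also have "\<dots> \<le> 3/5 * (9/10)" using p q by (intro mult_mono) auto
  also have "\<dots> \<le> 1/2 + 1/20" by simp
  finally have "p * (1/2 - 2/3 * q) \<le> 11/20" by simp
  moreover have "e^2 \<le> (1/10)^2" using e by (intro power_mono) auto
  ultimately have "(e^2 * p^2) * (p * (1/2 - 2/3 * q)) \<le> (1/100 * p^2) * (11/20)"
    by (intro order.trans[OF mult_left_mono mult_right_mono] mult_right_mono) (auto simp: power2_eq_square)
  then have "e^2 * p^3 * (1/2 - 2/3 * q) \<le> 11/2000 * p^2"
    by (simp add: power2_eq_square power3_eq_cube mult_ac)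
  with 1 show ?thesis using zero_le_power2[of p] by linarith
qed

text \<open>\<open>p\<close> and \<open>q\<close> are consecutive values of an orbit. The linear
  part \<open>(p, q) -> (q, q - c p)\<close> multiplies the quadratic part
  \<open>q^2 - p q + c p^2\<close> by exactly \<open>c\<close>.\<close>

definition V :: "real \<Rightarrow> real \<Rightarrow> real \<Rightarrow> real" where
  "V c p q = q^2 - p * q + c * p^2 - p^3 / 2 + 2 * p^2 * q - 3/2 * p * q^2 + q^3 / 2
     + p^4 / 3 - 3/2 * p^3 * q + 3/2 * p^2 * q^2 - 2/3 * p * q^3"

text \<open>The exact increment, sorted by powers of \<open>1 - c\<close> so that each group matches
  one of the three estimates above.\<close>

lemma V_step:
  "V c q (q - c * p - p * q) - V c p q =
    - (1/3 * ((p - q)^2 + p * q)^2) + (q * (p * q) * (p - q)^2 / 2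
      + (p * q)^2 * (q * (3 * p - q) / 2 + 2/3 * (q * (p * q))))
    + (1 - c) * (- (p^2 - p * q + q^2) + p * (3 * p - q) * (p - q) / 2 + p * q * (p^2 + p * q - q^2 / 2)
        + p^2 * q^2 * (q - 5/2 * p) - 2 * p^3 * q^3
        + (1 - c) * p^2 * (1 - 3/2 * p + p * q / 2 - q^2 / 2 + 2 * p * q^2)
        + (1 - c)^2 * p^3 * (1/2 - 2/3 * q))"
  unfolding V_def
  by (simp add: power2_eq_square power3_eq_cube power4_eq_xxxx algebra_simps
      add_divide_distrib diff_divide_distrib)

text \<open>The group without \<open>1 - c\<close> yields \<open>97/300 - 1/3 = - 1/100\<close>; the
  reserve and the correction cancel, so the factor of \<open>1 - c\<close> is at most zero.\<close>

lemma V_descent: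
  assumes c: "9/10 \<le> c" "c \<le> 1"
    and p: "- 3/5 \<le> p" "p \<le> 19/40" and q: "- 3/5 \<le> q" "q \<le> 19/40"
  shows "V c q (q - c * p - p * q) \<le> V c p q - (p^2 - p * q + q^2)^2 / 100"
proof -
  define Q where "Q = - (p^2 - p * q + q^2) + p * (3 * p - q) * (p - q) / 2 + p * q * (p^2 + p * q - q^2 / 2)
        + p^2 * q^2 * (q - 5/2 * p) - 2 * p^3 * q^3"
  define R where "R = (1 - c) * p^2 * (1 - 3/2 * p + p * q / 2 - q^2 / 2 + 2 * p * q^2)
        + (1 - c)^2 * p^3 * (1/2 - 2/3 * q)"
  have "Q \<le> - (43/200 * p^2)" unfolding Q_def by (rule quadratic_part_le[OF p q])
  moreover have "R \<le> 43/200 * p^2" unfolding R_def using c by (intro correction_le[OF p q]) auto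
  ultimately have "Q + R \<le> 0" by linarith
  then have "(1 - c) * (Q + R) \<le> 0" using c by (intro mult_nonneg_nonpos) auto
  moreover have "V c q (q - c * p - p * q) - V c p q = - (1/3 * ((p - q)^2 + p * q)^2)
      + (q * (p * q) * (p - q)^2 / 2 + (p * q)^2 * (q * (3 * p - q) / 2 + 2/3 * (q * (p * q))))
      + (1 - c) * (Q + R)"
    unfolding V_step Q_def R_def by (simp only: add.assoc)
  moreover have "((p - q)^2 + p * q)^2 = (p^2 - p * q + q^2)^2"
    by (simp add: power2_eq_square algebra_simps)
  ultimately show ?thesis
    using quartic_part_le[OF p q] by linarith
qed

text \<open>Near the origin the cubic part \<open>T\<close> and the quartic part \<open>U\<close>
  are small multiples of \<open>p^2\<close> and \<open>q^2\<close>, so the quadratic part dominates.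
  This turns descent into stability.\<close>

lemma V_bounds:
  assumes c: "9/10 \<le> c" "c \<le> 1" and p: "\<bar>p\<bar> \<le> 1/10" and q: "\<bar>q\<bar> \<le> 1/10"
  shows "1/10 * p^2 + 1/10 * q^2 \<le> V c p q" and "V c p q \<le> 2 * p^2 + 2 * q^2"
proof -
  have c_pp: "9/10 * p^2 \<le> c * p^2" "c * p^2 \<le> 1 * p^2" using c by (intro mult_right_mono; simp)+
  have pq: "2 * (p * q) \<le> p^2 + q^2" "- (2 * (p * q)) \<le> p^2 + q^2"
    using zero_le_power2[of "p - q"] zero_le_power2[of "p + q"] by (simp_all add: power2_diff power2_sum)
  have scale: "\<bar>s^2 * t\<bar> \<le> s^2 * k" if "\<bar>t\<bar> \<le> k" for s t k :: real
    using that by (simp add: abs_mult mult_left_mono)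
  have prod: "\<bar>s * t\<bar> \<le> 1/100" if "\<bar>s\<bar> \<le> 1/10" "\<bar>t\<bar> \<le> 1/10" for s t :: real
    using mult_mono[OF that] by (simp add: abs_mult)
  have bounds: "\<bar>p^2 * p\<bar> \<le> p^2 * (1/10)" "\<bar>p^2 * q\<bar> \<le> p^2 * (1/10)"
    "\<bar>q^2 * p\<bar> \<le> q^2 * (1/10)" "\<bar>q^2 * q\<bar> \<le> q^2 * (1/10)"
    "\<bar>p^2 * (p * p)\<bar> \<le> p^2 * (1/100)" "\<bar>p^2 * (p * q)\<bar> \<le> p^2 * (1/100)"
    "\<bar>p^2 * (q * q)\<bar> \<le> p^2 * (1/100)" "\<bar>q^2 * (p * q)\<bar> \<le> q^2 * (1/100)"
    by (intro scale prod p q)+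
  have V_eq: "V c p q = q^2 - p * q + c * p^2 - p^2 * p / 2 + 2 * (p^2 * q) - 3/2 * (q^2 * p) + q^2 * q / 2
     + p^2 * (p * p) / 3 - 3/2 * (p^2 * (p * q)) + 3/2 * (p^2 * (q * q)) - 2/3 * (q^2 * (p * q))"
    unfolding V_def
    by (simp add: power2_eq_square power3_eq_cube power4_eq_xxxx algebra_simps)
  note lower = bounds[THEN abs_le_D2] and upper = bounds[THEN abs_le_D1]
  define T where "T = - (p^2 * p / 2) + 2 * (p^2 * q) - 3/2 * (q^2 * p) + q^2 * q / 2"
  define U where "U = p^2 * (p * p) / 3 - 3/2 * (p^2 * (p * q)) + 3/2 * (p^2 * (q * q)) - 2/3 * (q^2 * (p * q))"
  have V: "V c p q = q^2 - p * q + c * p^2 + T + U"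
    unfolding V_eq T_def U_def by simp
  have T: "- (1/4 * p^2 + 1/5 * q^2) \<le> T" unfolding T_def using lower(2,4) upper(1,3) by linarith
  have T': "T \<le> 1/4 * p^2 + 1/5 * q^2" unfolding T_def using lower(1,3) upper(2,4) by linarith
  have U: "- (1/25 * p^2 + 1/100 * q^2) \<le> U" unfolding U_def using lower(5,7) upper(6,8) zero_le_power2[of p] zero_le_power2[of q] by linarith
  have U': "U \<le> 1/25 * p^2 + 1/100 * q^2" unfolding U_def using lower(6,8) upper(5,7) zero_le_power2[of p] zero_le_power2[of q] by linarith
  note pos = zero_le_power2[of p] zero_le_power2[of q]
  show "1/10 * p^2 + 1/10 * q^2 \<le> V c p q" unfolding V using T U c_pp(1) pq(1) pos by linarith
  show "V c p q \<le> 2 * p^2 + 2 * q^2" unfolding V using T' U' c_pp(2) pq(2) pos by linarith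
qed

section \<open>Eventual bounds along orbits\<close>

locale orbit =
  fixes c :: real and p :: "nat \<Rightarrow> real"
  assumes c_pos: "0 < c" and c_le: "c \<le> 1"
    and rec: "p (Suc (Suc n)) = p (Suc n) - c * p n - p n * p (Suc n)"
begin

lemma rec_mult: "c + p (Suc (Suc n)) = (c + p (Suc n)) * (1 - p n)"
  by (simp add: rec algebra_simps)

lemma rec_diff: "p (Suc (Suc n)) = p (Suc n) - p n * (c + p (Suc n))"
  by (simp add: rec algebra_simps)

text \<open>Two steps of \<open>rec_mult\<close> give
  \<open>c + p (n + 3) = (c + v) (1 - v) (1 - p n)\<close> with \<open>v = p (n + 1)\<close>, and
  \<open>(c + v) (1 - v) \<le> c\<close> for \<open>v \<le> 0\<close> because
  \<open>c \<le> 1\<close>.\<close>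

lemma upper_step:
  assumes "p (Suc n) \<le> 0" "- c \<le> p (Suc n)" "- B \<le> p n" "0 \<le> B"
  shows "p (n + 3) \<le> c * B"
proof -
  let ?v = "p (Suc n)"
  have "?v * (1 - c - ?v) \<le> 0" using assms c_le by (cases "1 - c - ?v \<ge> 0") (auto intro: mult_nonpos_nonneg)
  then have "(c + ?v) * (1 - ?v) \<le> c" by (simp add: algebra_simps)
  moreover have "0 \<le> (c + ?v) * (1 - ?v)" using assms by simp
  ultimately have "(c + ?v) * (1 - ?v) * (1 - p n) \<le> (c + ?v) * (1 - ?v) * (1 + B)"
    and "(c + ?v) * (1 - ?v) * (1 + B) \<le> c * (1 + B)"
    using assms by (intro mult_left_mono mult_right_mono; simp)+
  moreover have "c + p (n + 3) = (c + ?v) * (1 - ?v) * (1 - p n)"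
    using rec_mult[of n] rec_mult[of "Suc n"] by (simp add: numeral_3_eq_3 mult_ac)
  moreover have "c * (1 + B) = c + c * B" by (simp add: distrib_left)
  ultimately show ?thesis by linarith
qed

text \<open>Sharper than the previous bound: \<open>p (n + 1)\<close> cannot be small, as \<open>c + p (n + 2) \<le> (c + p (n + 1)) (1 + B)\<close>.\<close>

lemma upper_step_refined:
  assumes "p (n + 2) \<le> 0" "- c \<le> p (n + 2)" "- c \<le> p (n + 1)" "- B \<le> p n" "0 \<le> B"
  defines "y \<equiv> c + p (n + 2)"
  shows "p (n + 4) \<le> y * (1 + c - y) * (1 + c - y / (1 + B)) - c"
proof -
  have "y = (c + p (n + 1)) * (1 - p n)" using rec_mult[of n] by (simp add: y_def)
  also have "\<dots> \<le> (c + p (n + 1)) * (1 + B)" using assms by (intro mult_left_mono) auto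
  finally have "y / (1 + B) \<le> c + p (n + 1)" using assms by (simp add: field_simps)
  then have "1 - p (n + 1) \<le> 1 + c - y / (1 + B)" by simp
  moreover have "0 \<le> y * (1 + c - y)" using assms by (simp add: y_def)
  ultimately have "y * (1 + c - y) * (1 - p (n + 1)) \<le> y * (1 + c - y) * (1 + c - y / (1 + B))"
    by (rule mult_left_mono)
  moreover have "c + p (n + 4) = y * (1 + c - y) * (1 - p (n + 1))"
    using rec_mult[of "n + 1"] rec_mult[of "n + 2"] by (simp add: y_def numeral_eq_Suc mult_ac)
  ultimately show ?thesis by simp
qed

text \<open>\<open>(c + v) (1 - v)\<close> is concave in \<open>v\<close>, so on
  \<open>[0, P]\<close> it is at least one of its end values \<open>c\<close> and
  \<open>(c + P) (1 - P)\<close>. The last two hypotheses treat these two cases.\<close>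

lemma lower_step:
  assumes "0 \<le> p (Suc n)" "p (Suc n) \<le> P" "p n \<le> P" "P < 1"
    and "c * P \<le> B" "c - B \<le> (c + P) * (1 - P)^2"
  shows "- B \<le> p (n + 3)"
proof -
  let ?v = "p (Suc n)"
  have concave: "c \<le> (c + ?v) * (1 - ?v) \<or> (c + P) * (1 - P) \<le> (c + ?v) * (1 - ?v)"
  proof (cases "?v \<le> 1 - c")
    case True
    then have "?v * (1 - c - ?v) \<ge> 0" using assms by simp
    then show ?thesis by (simp add: algebra_simps)
  next
    case False
    then have "(P - ?v) * (P + ?v - (1 - c)) \<ge> 0" using assms by (intro mult_nonneg_nonneg) auto
    then show ?thesis by (simp add: algebra_simps)
  qed
  have "c - B \<le> (c + ?v) * (1 - ?v) * (1 - P)"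
    using concave
  proof
    assume "c \<le> (c + ?v) * (1 - ?v)"
    then have "c * (1 - P) \<le> (c + ?v) * (1 - ?v) * (1 - P)" using assms by (intro mult_right_mono) auto
    then show ?thesis using assms by (simp add: algebra_simps)
  next
    assume "(c + P) * (1 - P) \<le> (c + ?v) * (1 - ?v)"
    then have "(c + P) * (1 - P) * (1 - P) \<le> (c + ?v) * (1 - ?v) * (1 - P)"
      using assms by (intro mult_right_mono) auto
    moreover have "(c + P) * (1 - P)^2 = (c + P) * (1 - P) * (1 - P)" by (simp add: power2_eq_square)
    ultimately show ?thesis using assms(6) by linarith
  qed
  also have "\<dots> \<le> (c + ?v) * (1 - ?v) * (1 - p n)" using assms c_pos by (intro mult_left_mono) auto
  also have "\<dots> = c + p (n + 3)" using rec_mult[of n] rec_mult[of "Suc n"]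
    by (simp add: numeral_3_eq_3 mult_ac)
  finally show ?thesis by simp
qed

end

text \<open>The line is tangent to the cubic at \<open>P = (2 - c) / 2\<close>: the difference is
  exactly \<open>P * (P - (2 - c) / 2)^2\<close>. Its slope gives the contraction factor for small
  \<open>c\<close>.\<close>

lemma lower_factor:
  fixes c P :: real
  assumes "0 \<le> P"
  shows "c - (c + c^2 / 4) * P \<le> (c + P) * (1 - P)^2"
proof -
  have "0 \<le> P * (P - (2 - c) / 2)^2" using assms by simp
  then show ?thesis by (simp (no_asm_use) only: expand) 
qed

text \<open>In the original variable, with \<open>a = c + 1\<close>, the two bounds say that
  \<open>x\<close> lies strictly between 0 and 1.\<close>

locale bounded_orbit = orbit +
  assumes gt: "- c < p n" and lt: "p n < 1"
begin

text \<open>A step to \<open>p (n + 3)\<close> can go up only if \<open>p (n + 1) \<le> 0\<close>,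
  so an orbit that gets below \<open>P\<close> late enough stays there. An orbit remaining above
  \<open>P\<close> would drop by at least \<open>P^2\<close> at each step, contradicting
  boundedness.\<close>

lemma eventually_upper:
  assumes P: "0 < P" and ev: "\<forall>\<^sub>F n in sequentially. p (Suc n) \<le> 0 \<longrightarrow> p (n + 3) \<le> P"
  shows "\<forall>\<^sub>F n in sequentially. p n \<le> P"
proof -
  obtain N where N: "\<And>n. n \<ge> N \<Longrightarrow> p (Suc n) \<le> 0 \<Longrightarrow> p (n + 3) \<le> P"
    using ev by (auto simp: eventually_sequentially)
  have step: "p (Suc n) \<le> P" if "n \<ge> N + 2" "p n \<le> P" for n
  proof -
    obtain k where "n = N + 2 + k" using le_Suc_ex \<open>n \<ge> N + 2\<close> by blast
    then obtain m where m: "n = m + 2" "m \<ge> N" by (intro that[of "N + k"]) simp_all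
    show ?thesis
    proof (cases "p (Suc m) \<le> 0")
      case True
      then show ?thesis using N m by (simp add: numeral_3_eq_3)
    next
      case False
      then have "0 \<le> p (Suc m) * (c + p (Suc (Suc m)))" using gt[of "Suc (Suc m)"] by simp
      then show ?thesis using rec_diff[of "Suc m"] m that by simp
    qed
  qed
  show ?thesis
  proof (cases "\<exists>M \<ge> N + 2. p M \<le> P")
    case True
    then obtain M where M: "M \<ge> N + 2" "p M \<le> P" by blast
    have "p n \<le> P" if "n \<ge> M" for n
      using that by (induction n rule: dec_induct) (use M step in auto)
    then show ?thesis by (auto simp: eventually_sequentially)
  next
    case False
    then have above: "P < p n" if "n \<ge> N + 2" for n using that by force
    have "p (N + 3 + k) \<le> p (N + 3) - real k * P^2" for k
    proof (induction k)
      case (Suc k)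
      have "P * P \<le> p (N + 2 + k) * (c + p (N + 3 + k))"
        using above[of "N + 2 + k"] above[of "N + 3 + k"] P c_pos by (intro mult_mono) auto
      then show ?case using Suc rec_diff[of "N + 2 + k"]
        by (simp add: power2_eq_square algebra_simps numeral_3_eq_3)
    qed simp
    moreover obtain k where "1 < real k * P^2" using reals_Archimedean3[of "P^2"] P by auto
    ultimately have "p (N + 3 + k) < 0" using lt[of "N + 3"] by (smt (verit))
    then show ?thesis using above[of "N + 3 + k"] P by simp
  qed
qed

lemma eventually_lower:
  assumes B: "0 < B" and ev: "\<forall>\<^sub>F n in sequentially. 0 \<le> p (Suc n) \<longrightarrow> - B \<le> p (n + 3)"
  shows "\<forall>\<^sub>F n in sequentially. - B \<le> p n"
proof -
  obtain N where N: "\<And>n. n \<ge> N \<Longrightarrow> 0 \<le> p (Suc n) \<Longrightarrow> - B \<le> p (n + 3)"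
    using ev by (auto simp: eventually_sequentially)
  have step: "- B \<le> p (Suc n)" if "n \<ge> N + 2" "- B \<le> p n" for n
  proof -
    obtain k where "n = N + 2 + k" using le_Suc_ex \<open>n \<ge> N + 2\<close> by blast
    then obtain m where m: "n = m + 2" "m \<ge> N" by (intro that[of "N + k"]) simp_all
    show ?thesis
    proof (cases "0 \<le> p (Suc m)")
      case True
      then show ?thesis using N m by (simp add: numeral_3_eq_3)
    next
      case False
      then have "p (Suc m) * (c + p (Suc (Suc m))) \<le> 0"
        using gt[of "Suc (Suc m)"] by (intro mult_nonpos_nonneg) auto
      then show ?thesis using rec_diff[of "Suc m"] m that by simp
    qed
  qed
  show ?thesis
  proof (cases "\<exists>M \<ge> N + 2. - B \<le> p M")
    case True
    then obtain M where M: "M \<ge> N + 2" "- B \<le> p M" by blast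
    have "- B \<le> p n" if "n \<ge> M" for n
      using that by (induction n rule: dec_induct) (use M step in auto)
    then show ?thesis by (auto simp: eventually_sequentially)
  next
    case False
    then have below: "p n < - B" if "n \<ge> N + 2" for n using that by force
    \<comment> \<open>Unlike in the upper bound, the factor \<open>c + p\<close> could be close to
      0. While the orbit is negative it increases, so this factor stays at least its value
      \<open>g\<close> at \<open>N + 3\<close>.\<close>
    define g where "g = c + p (N + 3)"
    have g: "g > 0" using gt[of "N + 3"] by (simp add: g_def)
    have grow: "p (N + 3) + real k * (B * g) \<le> p (N + 3 + k)" for k
    proof (induction k)
      case (Suc k)
      have "0 \<le> real k * (B * g)" using B g by simp
      then have "g \<le> c + p (N + 3 + k)" using Suc unfolding g_def by linarith
      then have "B * g \<le> - p (N + 2 + k) * (c + p (N + 3 + k))"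
        using below[of "N + 2 + k"] B g by (intro mult_mono) auto
      then show ?case using Suc rec_diff[of "N + 2 + k"]
        by (simp add: algebra_simps numeral_3_eq_3)
    qed simp
    obtain k where "1 < real k * (B * g)" using reals_Archimedean3[of "B * g"] B g by auto
    then have "0 < p (N + 3 + k)" using grow[of k] gt[of "N + 3"] c_le by linarith
    then show ?thesis using below[of "N + 3 + k"] B by simp
  qed
qed

lemma upper_from_lower:
  assumes B: "0 < B" and ev: "\<forall>\<^sub>F n in sequentially. - B \<le> p n"
  shows "\<forall>\<^sub>F n in sequentially. p n \<le> c * B"
proof (rule eventually_upper)
  show "\<forall>\<^sub>F n in sequentially. p (Suc n) \<le> 0 \<longrightarrow> p (n + 3) \<le> c * B"
    using ev by eventually_elim (use B gt in \<open>auto intro: upper_step less_imp_le\<close>)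
qed (use B c_pos in simp)

lemma refined_upper_from_lower:
  assumes B: "0 < B" and P: "0 < P" and ev: "\<forall>\<^sub>F n in sequentially. - B \<le> p n"
    and bound: "\<And>y. 0 \<le> y \<Longrightarrow> y \<le> c \<Longrightarrow> y * (1 + c - y) * (1 + c - y / (1 + B)) - c \<le> P"
  shows "\<forall>\<^sub>F n in sequentially. p n \<le> P"
proof (rule eventually_upper[OF P])
  \<comment> \<open>\<open>upper_step_refined\<close> looks four steps ahead, one more than
    \<open>eventually_upper\<close> expects, so the statement is proved at \<open>Suc n\<close> and
    then shifted.\<close>
  have "\<forall>\<^sub>F n in sequentially. p (Suc (Suc n)) \<le> 0 \<longrightarrow> p (Suc n + 3) \<le> P"
    using ev
  proof eventually_elim
    case (elim n)
    show ?case
    proof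
      assume "p (Suc (Suc n)) \<le> 0"
      then show "p (Suc n + 3) \<le> P"
        using upper_step_refined[of n B] bound[of "c + p (n + 2)"] elim B gt[of "n + 2"] gt[of "n + 1"]
        by (simp add: numeral_eq_Suc)
    qed
  qed
  then show "\<forall>\<^sub>F n in sequentially. p (Suc n) \<le> 0 \<longrightarrow> p (n + 3) \<le> P"
    by (subst eventually_sequentially_Suc[symmetric])
qed

lemma lower_from_upper:
  assumes ev: "\<forall>\<^sub>F n in sequentially. p n \<le> P"
    and "0 < B" "P < 1" "c * P \<le> B" "c - B \<le> (c + P) * (1 - P)^2"
  shows "\<forall>\<^sub>F n in sequentially. - B \<le> p n"
proof (rule eventually_lower)
  have "\<forall>\<^sub>F n in sequentially. p (Suc n) \<le> P" using ev by (subst eventually_sequentially_Suc)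
  with ev show "\<forall>\<^sub>F n in sequentially. 0 \<le> p (Suc n) \<longrightarrow> - B \<le> p (n + 3)"
    by eventually_elim (use assms lower_step in blast)
qed fact

end

text \<open>The left-hand side is convex in \<open>c\<close>, so it is enough to check the two ends \<open>c = 9/10\<close> and \<open>c = 1\<close>.\<close>

lemma refined_cubic_le:
  fixes c y k r K P :: real
  assumes c: "9/10 \<le> c" "c \<le> 1" and y: "0 \<le> y"
    and ends: "(19/10)^2 * y - (1 + k) * (19/10) * y^2 + k * y^3 \<le> 9/10 + P"
      "2^2 * y - (1 + k) * 2 * y^2 + k * y^3 \<le> 1 + P"
  shows "y * (1 + c - y) * (1 + c - k * y) - c \<le> P"
proof -
  have "(10 * (1 - c)) * ((19/10)^2 * y - (1 + k) * (19/10) * y^2 + k * y^3)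
      \<le> (10 * (1 - c)) * (9/10 + P)"
    using c ends by (intro mult_left_mono) auto
  moreover have "(10 * c - 9) * (2^2 * y - (1 + k) * 2 * y^2 + k * y^3) \<le> (10 * c - 9) * (1 + P)"
    using c ends by (intro mult_left_mono) auto
  \<comment> \<open>The gap between the chord over \<open>[9/10, 1]\<close> and
    \<open>y * c^2\<close>, the only term not affine in \<open>c\<close>; the weights
    \<open>10 * (1 - c)\<close> and \<open>10 * c - 9\<close> sum to 1.\<close>
  moreover have "0 \<le> y * ((1 - c) * (c - 9/10))" using c y by (intro mult_nonneg_nonneg) auto
  ultimately show ?thesis by (simp (no_asm_use) only: expand)
qed

section \<open>Convergence of bounded orbits to zero\<close>

context bounded_orbit
begin

text \<open>A lower bound \<open>- B\<close> gives the upper bound \<open>c * B\<close>, which by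
  \<open>lower_factor\<close> gives the lower bound \<open>- (\<theta> * c * B)\<close>. At
  \<open>c = 9/10\<close> the factor \<open>\<theta> * c\<close> is 0.99225, just below 1.\<close>

lemma tendsto_zero_small_c:
  assumes c: "c \<le> 9/10"
  shows "p \<longlonglongrightarrow> 0"
proof -
  define \<theta> where "\<theta> = c + c^2 / 4"
  have c2: "c^2 \<le> (9/10)^2" using c c_pos by (intro power_mono) auto
  have "0 < \<theta>" unfolding \<theta>_def using c_pos by (simp add: add_pos_pos)
  then have \<theta>: "0 < \<theta>" "c \<le> \<theta>" "\<theta> \<le> 9/10 + 81/400" using c c2 c_pos by (auto simp: \<theta>_def power2_eq_square)
  have "\<theta> * c \<le> (9/10 + 81/400) * (9/10)" using \<theta> c c_pos by (intro mult_mono) auto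
  then have contr: "0 < \<theta> * c" "\<theta> * c < 1" using \<theta> c_pos by auto
  have low: "\<forall>\<^sub>F n in sequentially. - ((\<theta> * c) ^ k * c) \<le> p n" for k
  proof (induction k)
    case 0
    then show ?case using gt by (simp add: less_imp_le)
  next
    case (Suc k)
    define B where "B = (\<theta> * c) ^ k * c"
    have B: "0 < B" "B \<le> c" using contr c_pos by (auto simp: B_def power_le_one)
    have "c * B \<le> c * c" using B c_pos by (intro mult_left_mono) auto
    then have "c * B < 1" using c2 by (simp add: power2_eq_square)
    moreover have "c * (c * B) \<le> \<theta> * (c * B)" using B \<theta> c_pos by (intro mult_right_mono) auto
    moreover have "0 < \<theta> * (c * B)" using B \<theta> c_pos by simp
    moreover have "c - \<theta> * (c * B) \<le> (c + c * B) * (1 - c * B)^2"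
      using lower_factor[of "c * B" c] B c_pos by (simp add: \<theta>_def)
    ultimately have "\<forall>\<^sub>F n in sequentially. - (\<theta> * (c * B)) \<le> p n"
      using upper_from_lower[OF B(1)] Suc lower_from_upper[of "c * B" "\<theta> * (c * B)"] by (simp add: B_def)
    then show ?case by (simp add: B_def mult_ac)
  qed
  show ?thesis
  proof (rule LIMSEQ_I)
    fix r :: real assume r: "0 < r"
    obtain k where k: "(\<theta> * c) ^ k < r" using real_arch_pow_inv[OF r] contr by blast
    define B where "B = (\<theta> * c) ^ k * c"
    have "B \<le> (\<theta> * c) ^ k * 1" unfolding B_def using c_le contr by (intro mult_left_mono) auto
    with k have "B < r" by linarith
    moreover have "0 < B" unfolding B_def using contr c_pos by simp
    ultimately have B: "0 < B" "B < r" by auto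
    have "c * B \<le> 1 * B" using c_le B by (intro mult_right_mono) auto
    have "\<forall>\<^sub>F n in sequentially. p n \<le> c * B" using upper_from_lower[OF B(1)] low[of k] by (simp add: B_def)
    moreover have "\<forall>\<^sub>F n in sequentially. - B \<le> p n" using low[of k] by (simp add: B_def)
    ultimately have "\<forall>\<^sub>F n in sequentially. norm (p n - 0) < r"
      by eventually_elim (use \<open>c * B \<le> 1 * B\<close> B in \<open>unfold real_norm_def, linarith\<close>)
    then show "\<exists>no. \<forall>n\<ge>no. norm (p n - 0) < r" by (simp add: eventually_sequentially)
  qed
qed

text \<open>Two rounds of alternating bounds: \<open>- 1\<close>, \<open>11/20\<close>,
  \<open>- 7/10\<close>, \<open>19/40\<close>, \<open>- 3/5\<close>. At \<open>c = 1\<close> the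
  plain upper bound from \<open>- 1\<close> is only 1, while \<open>lower_from_upper\<close> needs
  \<open>P < 1\<close>; hence the refined one.\<close>

lemma eventually_in_box:
  assumes c: "9/10 \<le> c"
  shows "\<forall>\<^sub>F n in sequentially. - 3/5 \<le> p n \<and> p n \<le> 19/40"
proof -
  have "\<forall>\<^sub>F n in sequentially. - 1 \<le> p n" using gt c_le by (intro always_eventually) (smt (verit))
  then have "\<forall>\<^sub>F n in sequentially. p n \<le> 11/20"
  proof (intro refined_upper_from_lower[of 1])
    fix y assume y: "0 \<le> y" "y \<le> c"
    have "y * (1 + c - y) * (1 + c - 1/2 * y) - c \<le> 11/20"
    proof (rule refined_cubic_le[OF c c_le y(1)])
      show "(19/10)^2 * y - (1 + 1/2) * (19/10) * y^2 + 1/2 * y^3 \<le> 9/10 + 11/20"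
      proof -
        \<comment> \<open>The double root is near the maximum of the cubic, and the other root is
          chosen to match the \<open>y^2\<close> coefficient, so the remainder is linear in
          \<open>y\<close>. The next three certificates are built alike.\<close>
        have "0 \<le> (y - 85/100)^2 * (4 - y)" using y c_le by simp
        then show ?thesis using y c_le by (simp (no_asm_use) only: expand)
      qed
      show "2^2 * y - (1 + 1/2) * 2 * y^2 + 1/2 * y^3 \<le> 1 + 11/20"
      proof -
        have "0 \<le> (y - 845/1000)^2 * (431/100 - y)" using y c_le by simp
        then show ?thesis using y c_le by (simp (no_asm_use) only: expand)
      qed
    qed
    then show "y * (1 + c - y) * (1 + c - y / (1 + 1)) - c \<le> 11/20" by simp
  qed auto
  then have "\<forall>\<^sub>F n in sequentially. - (7/10) \<le> p n"
    by (rule lower_from_upper) (use c c_le in \<open>auto simp: power2_eq_square\<close>)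
  then have "\<forall>\<^sub>F n in sequentially. p n \<le> 19/40"
  proof (intro refined_upper_from_lower[of "7/10"])
    fix y assume y: "0 \<le> y" "y \<le> c"
    have "y * (1 + c - y) * (1 + c - 10/17 * y) - c \<le> 19/40"
    proof (rule refined_cubic_le[OF c c_le y(1)])
      show "(19/10)^2 * y - (1 + 10/17) * (19/10) * y^2 + 10/17 * y^3 \<le> 9/10 + 19/40"
      proof -
        have "0 \<le> (y - 8/10)^2 * (353/100 - y)" using y c_le by simp
        then show ?thesis using y c_le by (simp (no_asm_use) only: expand)
      qed
      show "2^2 * y - (1 + 10/17) * 2 * y^2 + 10/17 * y^3 \<le> 1 + 19/40"
      proof -
        have "0 \<le> (y - 81/100)^2 * (378/100 - y)" using y c_le by simp
        then show ?thesis using y c_le by (simp (no_asm_use) only: expand)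
      qed
    qed
    then show "y * (1 + c - y) * (1 + c - y / (1 + 7/10)) - c \<le> 19/40" by (simp add: mult.commute[of y 10])
  qed auto
  moreover from this have "\<forall>\<^sub>F n in sequentially. - (3/5) \<le> p n"
    by (rule lower_from_upper) (use c c_le in \<open>auto simp: power2_eq_square\<close>)
  ultimately show ?thesis by eventually_elim auto
qed

text \<open>Once in the box, \<open>V\<close> decreases along the orbit and is bounded by
  compactness, so its increments tend to 0. These dominate \<open>(E n)^2 / 100\<close>, and
  \<open>E\<close> is a positive definite form.\<close>

lemma tendsto_zero_large_c:
  assumes c: "9/10 \<le> c"
  shows "p \<longlonglongrightarrow> 0"
proof -
  obtain N where N: "\<And>n. n \<ge> N \<Longrightarrow> - 3/5 \<le> p n \<and> p n \<le> 19/40"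
    using eventually_in_box[OF c] by (auto simp: eventually_sequentially)
  define q where "q n = p (n + N)" for n
  have q: "- 3/5 \<le> q n" "q n \<le> 19/40" for n using N[of "n + N"] by (auto simp: q_def)
  define W where "W n = V c (q n) (q (Suc n))" for n
  define E where "E n = (q n)^2 - q n * q (Suc n) + (q (Suc n))^2" for n
  have descent: "W (Suc n) \<le> W n - (E n)^2 / 100" for n
    using V_descent[OF c c_le q[of n] q[of "Suc n"]] by (simp add: W_def E_def q_def rec)
  have "decseq W" by (rule decseq_SucI) (use descent in \<open>smt (verit) divide_nonneg_pos zero_le_power2\<close>)
  moreover have "bounded (range W)"
  proof -
    have "compact ((\<lambda>(x, y). V c x y) ` ({-3/5..19/40} \<times> {-3/5..19/40}))"
      unfolding V_def case_prod_beta by (intro compact_continuous_image compact_Times continuous_intros) auto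
    then have "bounded ((\<lambda>(x, y). V c x y) ` ({-3/5..19/40} \<times> {-3/5..19/40}))"
      by (rule compact_imp_bounded)
    moreover have "range W \<subseteq> (\<lambda>(x, y). V c x y) ` ({-3/5..19/40} \<times> {-3/5..19/40})"
      using q by (fastforce simp: W_def)
    ultimately show ?thesis by (rule bounded_subset)
  qed
  then obtain K where "\<And>n. \<bar>W n\<bar> \<le> K" by (auto simp: bounded_iff)
  then have "\<forall>n. - K \<le> W n" by (simp add: abs_le_iff minus_le_iff)
  ultimately obtain L where L: "W \<longlonglongrightarrow> L" by (rule decseq_convergent)
  have E_pos: "3/4 * (q n)^2 \<le> E n" for n
    using zero_le_power2[of "q n / 2 - q (Suc n)"] by (simp add: E_def power2_eq_square algebra_simps)
  have "(\<lambda>n. 100 * (W n - W (Suc n))) \<longlonglongrightarrow> 100 * (L - L)"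
    by (intro tendsto_intros L LIMSEQ_Suc[OF L])
  then have "(\<lambda>n. 100 * (W n - W (Suc n))) \<longlonglongrightarrow> 0" by simp
  then have "(\<lambda>n. (E n)^2) \<longlonglongrightarrow> 0"
    by (rule tendsto_sandwich[OF _ _ tendsto_const, rotated 2])
      (use descent in \<open>auto simp: field_simps\<close>)
  then have "(\<lambda>n. sqrt ((E n)^2)) \<longlonglongrightarrow> sqrt 0" by (rule tendsto_real_sqrt)
  moreover have "E n \<ge> 0" for n using E_pos[of n] zero_le_power2[of "q n"] by linarith
  ultimately have "E \<longlonglongrightarrow> 0" by simp
  then have "(\<lambda>n. 4/3 * E n) \<longlonglongrightarrow> 0" by (rule tendsto_mult_right_zero)
  then have "(\<lambda>n. (q n)^2) \<longlonglongrightarrow> 0"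
    by (rule tendsto_sandwich[OF _ _ tendsto_const, rotated 2])
      (use E_pos in \<open>auto simp: field_simps\<close>)
  then have "(\<lambda>n. sqrt ((q n)^2)) \<longlonglongrightarrow> sqrt 0" by (rule tendsto_real_sqrt)
  then have "q \<longlonglongrightarrow> 0" by (simp add: tendsto_rabs_zero_iff)
  then show ?thesis unfolding q_def by (rule LIMSEQ_offset)
qed

lemma tendsto_zero: "p \<longlonglongrightarrow> 0"
  using tendsto_zero_small_c tendsto_zero_large_c by linarith

end

section \<open>Stability\<close>

text \<open>The interval from \<open>- B\<close> to \<open>c * B\<close> traps the orbit, since the
  two bounds contract. Taking \<open>B < c\<close> keeps \<open>c + p n\<close> positive, and
  \<open>\<delta> = c * B / 3\<close> puts \<open>p 2\<close> inside as well.\<close>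

lemma orbit_stable_small_c:
  fixes c \<epsilon> :: real
  assumes c: "0 < c" "c \<le> 9/10" and \<epsilon>: "0 < \<epsilon>"
  shows "\<exists>\<delta>>0. \<forall>p. orbit c p \<longrightarrow> \<bar>p 0\<bar> < \<delta> \<longrightarrow> \<bar>p 1\<bar> < \<delta> \<longrightarrow> (\<forall>n. \<bar>p n\<bar> < \<epsilon>)"
proof -
  define B where "B = min (\<epsilon> / 2) (c / 2)"
  define \<delta> where "\<delta> = c * B / 3"
  have B: "0 < B" "B < \<epsilon>" "B < c" using c \<epsilon> by (auto simp: B_def)
  have cB: "0 < c * B" "c * B \<le> B" using B c by (auto simp: mult_le_cancel_right1)
  have c2: "c^2 \<le> (9/10)^2" using c by (intro power_mono) auto
  have "(c + c^2 / 4) * c \<le> (9/10 + 81/400) * (9/10)"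
    using c c2 by (intro mult_mono) (auto simp: power2_eq_square)
  then have "(c + c^2 / 4) * c * B \<le> 1 * B" using B by (intro mult_right_mono) auto
  then have "c - B \<le> c - (c + c^2 / 4) * (c * B)" by (simp add: mult.assoc)
  also have "\<dots> \<le> (c + c * B) * (1 - c * B)^2" using lower_factor cB by simp
  finally have P: "c - B \<le> (c + c * B) * (1 - c * B)^2" .
  have "c * (c * B) \<le> 1 * (c * B)" using c cB by (intro mult_right_mono) auto
  with cB have cP: "c * (c * B) \<le> B" by linarith
  have "\<bar>p n\<bar> < \<epsilon>" if "orbit c p" and start: "\<bar>p 0\<bar> < \<delta>" "\<bar>p 1\<bar> < \<delta>" for p n
  proof -
    interpret orbit c p by fact
    \<comment> \<open>A window of three values is carried along because \<open>upper_step\<close>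
      and \<open>lower_step\<close> pass from \<open>n\<close> and \<open>n + 1\<close> to
      \<open>n + 3\<close>, while the monotone cases compare with \<open>n + 2\<close>.\<close>
    have "- B \<le> p n \<and> p n \<le> c * B \<and> - B \<le> p (n + 1) \<and> p (n + 1) \<le> c * B
      \<and> - B \<le> p (n + 2) \<and> p (n + 2) \<le> c * B"
    proof (induction n)
      case 0
      have "\<delta> \<le> 1" unfolding \<delta>_def using cB B c by linarith
      have "\<bar>c * p 0\<bar> \<le> 1 * \<delta>" unfolding abs_mult using c start by (intro mult_mono) auto
      moreover have "\<bar>p 0 * p 1\<bar> \<le> \<delta> * 1" unfolding abs_mult using \<open>\<delta> \<le> 1\<close> start by (intro mult_mono) auto
      ultimately have "\<bar>p 2\<bar> \<le> 3 * \<delta>"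
        using rec[of 0] start by (simp add: numeral_2_eq_2)
      then show ?case using start cB by (auto simp: \<delta>_def numeral_2_eq_2)
    next
      case (Suc n)
      have pos: "0 \<le> c + p (n + 2)" using Suc B by linarith
      have "p (n + 3) \<le> c * B"
      proof (cases "p (Suc n) \<le> 0")
        case True
        then show ?thesis using Suc B by (intro upper_step) auto
      next
        case False
        then have "0 \<le> p (Suc n) * (c + p (n + 2))" using pos by simp
        then show ?thesis using rec_diff[of "Suc n"] Suc by (simp add: numeral_eq_Suc)
      qed
      moreover have "- B \<le> p (n + 3)"
      proof (cases "0 \<le> p (Suc n)")
        case True
        then show ?thesis using Suc B P cP cB c by (intro lower_step[of n "c * B" B]) auto
      next
        case False
        then have "p (Suc n) * (c + p (n + 2)) \<le> 0" using pos by (intro mult_nonpos_nonneg) auto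
        then show ?thesis using rec_diff[of "Suc n"] Suc by (simp add: numeral_eq_Suc)
      qed
      ultimately show ?case using Suc by (simp add: numeral_eq_Suc)
    qed
    then show ?thesis using B cB by (auto simp: abs_less_iff)
  qed
  moreover have "0 < \<delta>" using cB by (simp add: \<delta>_def)
  ultimately show ?thesis by blast
qed

text \<open>A small sublevel set of \<open>V\<close> traps the orbit. The bound
  \<open>\<rho> \<le> 1/40\<close> keeps the next value within \<open>3 * \<rho> \<le> 1/10\<close>,
  where \<open>V_bounds\<close> applies.\<close>

lemma orbit_stable_large_c:
  fixes c \<epsilon> :: real
  assumes c: "9/10 \<le> c" "c \<le> 1" and \<epsilon>: "0 < \<epsilon>"
  shows "\<exists>\<delta>>0. \<forall>p. orbit c p \<longrightarrow> \<bar>p 0\<bar> < \<delta> \<longrightarrow> \<bar>p 1\<bar> < \<delta> \<longrightarrow> (\<forall>n. \<bar>p n\<bar> < \<epsilon>)"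
proof -
  define \<rho> where "\<rho> = min (\<epsilon> / 2) (1/40)"
  \<comment> \<open>Initially \<open>V \<le> 4 * \<delta>^2\<close>, so later values satisfy
    \<open>p^2 \<le> 40 * \<delta>^2\<close>, and \<open>40/49 < 1\<close>.\<close>
  define \<delta> where "\<delta> = \<rho> / 7"
  have \<rho>: "0 < \<rho>" "\<rho> < \<epsilon>" "\<rho> \<le> 1/40" using \<epsilon> by (auto simp: \<rho>_def)
  have "\<bar>p n\<bar> < \<epsilon>" if "orbit c p" and start: "\<bar>p 0\<bar> < \<delta>" "\<bar>p 1\<bar> < \<delta>" for p n
  proof -
    interpret orbit c p by fact
    have "\<bar>p n\<bar> \<le> \<rho> \<and> \<bar>p (n + 1)\<bar> \<le> \<rho> \<and> V c (p n) (p (n + 1)) \<le> 4 * \<delta>^2"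
    proof (induction n)
      case 0
      have "\<bar>p 0\<bar>^2 \<le> \<delta>^2" "\<bar>p 1\<bar>^2 \<le> \<delta>^2" using start by (intro power_mono; simp)+
      then show ?case using V_bounds(2)[OF c, of "p 0" "p 1"] start \<rho> by (auto simp: \<delta>_def)
    next
      case (Suc n)
      have "V c (p (n + 1)) (p (n + 2)) \<le> V c (p n) (p (n + 1))"
      proof -
        have "p (n + 2) = p (n + 1) - c * p n - p n * p (n + 1)" using rec[of n] by simp
        moreover have "- 3/5 \<le> p n" "p n \<le> 19/40" "- 3/5 \<le> p (n + 1)" "p (n + 1) \<le> 19/40"
          using Suc \<rho> by (auto simp: abs_le_iff)
        ultimately have "V c (p (n + 1)) (p (n + 2))
            \<le> V c (p n) (p (n + 1)) - ((p n)^2 - p n * p (n + 1) + (p (n + 1))^2)^2 / 100"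
          using V_descent[OF c] by simp
        also have "\<dots> \<le> V c (p n) (p (n + 1))" by simp
        finally show ?thesis .
      qed
      then have V: "V c (p (n + 1)) (p (n + 2)) \<le> 4 * \<delta>^2" using Suc by linarith
      have "\<bar>c * p n\<bar> \<le> 1 * \<rho>" unfolding abs_mult using c Suc by (intro mult_mono) auto
      moreover have "\<bar>p n * p (n + 1)\<bar> \<le> \<rho> * 1" unfolding abs_mult using Suc \<rho> by (intro mult_mono) auto
      moreover have "p (n + 2) = p (n + 1) - c * p n - p n * p (n + 1)" using rec[of n] by simp
      moreover have "\<bar>p (n + 1)\<bar> \<le> \<rho>" using Suc by simp
      ultimately have "\<bar>p (n + 2)\<bar> \<le> 1/10" using \<rho> by linarith
      then have "1/10 * (p (n + 1))^2 + 1/10 * (p (n + 2))^2 \<le> V c (p (n + 1)) (p (n + 2))"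
        using Suc \<rho> by (intro V_bounds(1)[OF c]) auto
      then have "1/10 * (p (n + 2))^2 \<le> 4 * \<delta>^2" using V zero_le_power2[of "p (n + 1)"] by linarith
      moreover have "\<delta>^2 = \<rho>^2 / 49" by (simp add: \<delta>_def power_divide)
      ultimately have "(p (n + 2))^2 \<le> \<rho>^2" using zero_le_power2[of \<rho>] by linarith
      then have "\<bar>p (n + 2)\<bar> \<le> \<rho>" using \<rho> by (simp add: abs_le_square_iff[symmetric])
      then show ?case using Suc V by simp
    qed
    then show ?thesis using \<rho> by auto
  qed
  moreover have "0 < \<delta>" using \<rho> by (simp add: \<delta>_def)
  ultimately show ?thesis by blast
qed

lemma orbit_stable:
  fixes c \<epsilon> :: real
  assumes "0 < c" "c \<le> 1" "0 < \<epsilon>"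
  shows "\<exists>\<delta>>0. \<forall>p. orbit c p \<longrightarrow> \<bar>p 0\<bar> < \<delta> \<longrightarrow> \<bar>p 1\<bar> < \<delta> \<longrightarrow> (\<forall>n. \<bar>p n\<bar> < \<epsilon>)"
proof (cases "c \<le> 9/10")
  case True
  then show ?thesis using orbit_stable_small_c assms by blast
next
  case False
  then show ?thesis using orbit_stable_large_c[of c \<epsilon>] assms by simp
qed

section \<open>The delayed logistic map\<close>

lemma F_iterate:
  "(F a ^^ n) z = (fst ((F a ^^ n) z), fst ((F a ^^ Suc n) z))"
  by (simp add: F_def case_prod_beta prod_eq_iff)

lemma F_rec:
  "fst ((F a ^^ Suc (Suc n)) z) = a * fst ((F a ^^ Suc n) z) * (1 - fst ((F a ^^ n) z))"
  by (simp add: F_def case_prod_beta)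

text \<open>Valid for every starting point, as stability requires; the bounds of
  \<open>bounded_orbit\<close> are established separately on \<open>S a\<close>.\<close>

lemma orbit_F:
  assumes "1 < a" "a \<le> 2"
  shows "orbit (a - 1) (\<lambda>n. a * fst ((F a ^^ n) z) - (a - 1))"
proof
  fix n
  show "a * fst ((F a ^^ Suc (Suc n)) z) - (a - 1) = a * fst ((F a ^^ Suc n) z) - (a - 1)
      - (a - 1) * (a * fst ((F a ^^ n) z) - (a - 1))
      - (a * fst ((F a ^^ n) z) - (a - 1)) * (a * fst ((F a ^^ Suc n) z) - (a - 1))"
    unfolding F_rec by (simp add: algebra_simps)
qed (use assms in auto)

text \<open>The new product is \<open>a^2 * y * (1 - y) * (1 - x)\<close>, at most
  \<open>4 * y * (1 - y)\<close>. This is strictly below 1 except at \<open>y = 1/2\<close>, where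
  the hypothesis \<open>a * y * (1 - x) < 1\<close> supplies strictness.\<close>

lemma F_mem_S:
  assumes a: "1 < a" "a \<le> 2" and z: "z \<in> S a"
  shows "F a z \<in> S a"
proof -
  obtain x y where z_eq: "z = (x, y)" by fastforce
  with z have xy: "0 \<le> x" "x < 1" "0 < y" "y < 1" "a * y * (1 - x) < 1" by (auto simp: S_def)
  let ?w = "a * y * (1 - x)"
  have w: "0 < ?w" using xy a by simp
  have "a * ?w * (1 - y) < 1"
  proof (cases "y = 1/2")
    case True
    have "a / 2 * ?w \<le> 1 * ?w" using a w by (intro mult_right_mono) auto
    moreover have "a * ?w * (1 - y) = a / 2 * ?w" using True by simp
    ultimately show ?thesis using xy by linarith
  next
    case False
    then have "0 < (2 * y - 1)^2" by simp
    then have y4: "4 * (y * (1 - y)) < 1" by (simp add: power2_eq_square algebra_simps)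
    have "a^2 \<le> 2^2" using a by (intro power_mono) auto
    then have "a^2 * (y * (1 - y)) \<le> 4 * (y * (1 - y))" using xy by (intro mult_right_mono) auto
    moreover have "a^2 * (y * (1 - y)) * (1 - x) \<le> a^2 * (y * (1 - y)) * 1"
      using xy by (intro mult_left_mono) auto
    moreover have "a * ?w * (1 - y) = a^2 * (y * (1 - y)) * (1 - x)"
      by (simp add: power2_eq_square mult_ac)
    ultimately show ?thesis using y4 by linarith
  qed
  then show ?thesis using xy w by (simp add: z_eq F_def S_def)
qed

lemma F_tendsto:
  assumes a: "1 < a" "a \<le> 2" and z: "z \<in> S a"
  shows "(\<lambda>n. (F a ^^ n) z) \<longlonglongrightarrow> (1 - 1 / a, 1 - 1 / a)"
proof -
  define x where "x n = fst ((F a ^^ n) z)" for n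
  have mem: "(F a ^^ n) z \<in> S a" for n
    by (induction n) (use z F_mem_S[OF a] in auto)
  have iter: "(F a ^^ n) z = (x n, x (Suc n))" for n unfolding x_def by (rule F_iterate)
  with mem have "(x n, x (Suc n)) \<in> S a" for n by metis
  then have x: "0 < x (Suc n)" "x (Suc n) < 1" for n by (auto simp: S_def)
  have "orbit (a - 1) (\<lambda>n. a * x n - (a - 1))" unfolding x_def by (rule orbit_F[OF a])
  then interpret orbit "a - 1" "\<lambda>n. a * x n - (a - 1)" .
  \<comment> \<open>The orbit starts at index 1: \<open>S a\<close> admits \<open>x = 0\<close>,
    where the strict lower bound \<open>gt\<close> would fail.\<close>
  interpret bounded_orbit "a - 1" "\<lambda>n. a * x (Suc n) - (a - 1)"
    by unfold_locales (use a x rec in \<open>auto simp: mult_less_cancel_left2\<close>)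
  have "(\<lambda>n. (a * x (Suc n) - (a - 1) + (a - 1)) / a) \<longlonglongrightarrow> (0 + (a - 1)) / a"
    by (intro tendsto_intros tendsto_zero) (use a in auto)
  then have lim: "(\<lambda>n. x (Suc n)) \<longlonglongrightarrow> 1 - 1 / a" using a by (simp add: diff_divide_distrib)
  then have "(\<lambda>n. (x n, x (Suc n))) \<longlonglongrightarrow> (1 - 1 / a, 1 - 1 / a)"
    by (intro tendsto_Pair LIMSEQ_imp_Suc[OF lim])
  then show ?thesis unfolding iter .
qed

text \<open>Deviations from \<open>A\<close> are scaled by \<open>a\<close>, which lies between 1
  and 2, hence the radius \<open>\<delta> / 2\<close>. The bound \<open>\<epsilon> / 2\<close>
  allows for adding the two coordinates.\<close>

lemma F_lyapunov_stable:
  assumes a: "1 < a" "a \<le> 2"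
  defines "A \<equiv> 1 - 1 / a"
  shows "lyapunov_stable (F a) (A, A)"
  unfolding lyapunov_stable_def
proof (intro allI impI)
  fix \<epsilon> :: real assume \<epsilon>: "0 < \<epsilon>"
  have aA: "a * t - (a - 1) = a * (t - A)" for t using a by (simp add: A_def field_simps)
  obtain \<delta> where \<delta>: "0 < \<delta>" and stable: "\<And>p n. orbit (a - 1) p \<Longrightarrow> \<bar>p 0\<bar> < \<delta> \<Longrightarrow> \<bar>p 1\<bar> < \<delta> \<Longrightarrow> \<bar>p n\<bar> < \<epsilon> / 2"
    using orbit_stable[of "a - 1" "\<epsilon> / 2"] a \<epsilon> by auto
  have "dist ((F a ^^ n) z) (A, A) < \<epsilon>" if z: "dist z (A, A) < \<delta> / 2" for n z
  proof -
    define x where "x n = fst ((F a ^^ n) z)" for n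
    define p where "p n = a * x n - (a - 1)" for n
    have orb: "orbit (a - 1) p" unfolding p_def x_def by (rule orbit_F[OF a])
    have abs_p: "\<bar>p n\<bar> = a * \<bar>x n - A\<bar>" for n using a by (simp add: p_def aA abs_mult)
    have iter: "(F a ^^ n) z = (x n, x (Suc n))" for n unfolding x_def by (rule F_iterate)
    have "z = (x 0, x 1)" using iter[of 0] by simp
    then have near: "\<bar>x 0 - A\<bar> < \<delta> / 2" "\<bar>x 1 - A\<bar> < \<delta> / 2"
      using z dist_fst_le[of z "(A, A)"] dist_snd_le[of z "(A, A)"] by (auto simp: dist_real_def)
    have "\<bar>p i\<bar> < \<delta>" if "\<bar>x i - A\<bar> < \<delta> / 2" for i
    proof -
      have "a * \<bar>x i - A\<bar> \<le> 2 * \<bar>x i - A\<bar>" using a by (intro mult_right_mono) auto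
      with that show ?thesis by (simp add: abs_p)
    qed
    with near have small: "\<bar>p i\<bar> < \<epsilon> / 2" for i using stable[OF orb] by simp
    have "\<bar>x i - A\<bar> < \<epsilon> / 2" for i
    proof -
      have "1 * \<bar>x i - A\<bar> \<le> a * \<bar>x i - A\<bar>" using a by (intro mult_right_mono) auto
      with small[of i] show ?thesis by (simp add: abs_p)
    qed
    from this[of n] this[of "Suc n"] have "\<bar>x n - A\<bar> + \<bar>x (Suc n) - A\<bar> < \<epsilon>" by linarith
    moreover have "dist ((F a ^^ n) z) (A, A) \<le> \<bar>x n - A\<bar> + \<bar>x (Suc n) - A\<bar>"
      unfolding iter dist_Pair_Pair dist_real_def by (rule sqrt_sum_squares_le_sum_abs[THEN order_trans]) simp
    ultimately show ?thesis by linarith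
  qed
  then show "\<exists>\<delta>>0. \<forall>z. dist z (A, A) < \<delta> \<longrightarrow> (\<forall>n. dist ((F a ^^ n) z) (A, A) < \<epsilon>)"
    using \<delta> by (intro exI[of _ "\<delta> / 2"]) auto
qed

text \<open>\<open>S a\<close> contains boundary points with \<open>x = 0\<close>, so the
  neighbourhood is found in the open subset \<open>U\<close>, which contains \<open>(A, A)\<close>
  because \<open>a * A * (1 - A) = A < 1\<close>.\<close>

lemma F_locally_attracting:
  assumes a: "1 < a" "a \<le> 2"
  defines "A \<equiv> 1 - 1 / a"
  shows "locally_attracting (F a) (A, A)"
proof -
  define U where "U = {z :: real \<times> real. 0 < fst z \<and> fst z < 1 \<and> 0 < snd z \<and> snd z < 1 \<and> a * snd z * (1 - fst z) < 1}"
  have "open U" unfolding U_def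
    by (intro open_Collect_conj open_Collect_less continuous_intros)
  moreover have "(A, A) \<in> U" using a by (auto simp: U_def A_def field_simps)
  ultimately obtain \<eta> where "0 < \<eta>" and "ball (A, A) \<eta> \<subseteq> U" by (meson open_contains_ball)
  moreover have "U \<subseteq> S a" by (auto simp: U_def S_def)
  ultimately have "z \<in> S a" if "dist z (A, A) < \<eta>" for z
    using that by (auto simp: dist_commute)
  then show ?thesis
    unfolding locally_attracting_def A_def using F_tendsto[OF a] \<open>0 < \<eta>\<close> A_def by blast
qed

theorem theorem1:
  fixes a A :: real
  assumes "1 < a" and "a \<le> 2" and "A = 1 - 1 / a"
  shows "is_fixed_point (F a) (A, A)
    \<and> locally_asymptotically_stable (F a) (A, A)
    \<and> (\<forall>(x, y) \<in> S a. (\<lambda>n. (F a ^^ n) (x, y)) \<longlonglongrightarrow> (A, A))"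
proof (intro conjI)
  show "is_fixed_point (F a) (A, A)"
    using assms by (simp add: is_fixed_point_def F_def)
  show "locally_asymptotically_stable (F a) (A, A)"
    using F_lyapunov_stable F_locally_attracting assms by (simp add: locally_asymptotically_stable_def)
  show "\<forall>(x, y) \<in> S a. (\<lambda>n. (F a ^^ n) (x, y)) \<longlonglongrightarrow> (A, A)"
    using F_tendsto assms by auto
qed

end
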